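(* Let $(X,\rho)$ be a metric space of finite diameter, $Y\subsetneq X$ a nonempty proper subset, $\varepsilon>0$, $\mu\in(0,1)$, and $B_\varepsilon(x)=\{y\in X:\rho(x,y)<\varepsilon\}$. Assume that the collection $(X,Y,\{B_\varepsilon(x):x\in Y\})$ is admissible. Let $F:X\to\mathbb{R}$ and $f:X\to\mathbb{R}$ satisfy \[ \sup_X|F|+\sup_X|f|<\infty\qquad\text{and}\qquad\inf_Y f>0 . \] Let $\underline{v}:X\to\mathbb{R}$ be a subsolution and $\bar v:X\to\mathbb{R}$ a supersolution (for the data $f,F$), with $\sup_X|\underline{v}|+\sup_X|\bar v|<\infty$. Then $\underline{v}(x)\le\bar v(x)$ for all $x\in X$.
   Context: Admissibility: the collection $(X,Y,\{B_\varepsilon(x):x\in Y\})$ is admissible if $X$, $Y$, $X\setminus Y$ and all $B_\varepsilon(x)$ are nonempty, and there is a finite integer $D\in\mathbb{N}$ such that for every $x\in Y$ there are $d=d(x)<D$ and a chain $x_0,\dots,x_d\in X$ with $x_0=x$, $x_d\in X\setminus Y$ and $x_i\in B_\varepsilon(x_{i-1})$ for all $i\in\{1,\dots,d\}$. A function $u:X\to\mathbb{R}$ is a subsolution if $u(x)\le\mu\sup_{B_\varepsilon(x)}u+(1-\mu)\inf_{B_\varepsilon(x)}u+f(x)$ for $x\in Y$ and $u(x)=F(x)$ for $x\in X\setminus Y$. It is a supersolution if $u(x)\ge\mu\sup_{B_\varepsilon(x)}u+(1-\mu)\inf_{B_\varepsilon(x)}u+f(x)$ for $x\in Y$ and $u(x)=F(x)$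 for $x\in X\setminus Y$. *)

theory Defs
  imports "HOL-Analysis.Abstract_Metric_Spaces"
begin

text \<open>
  A chain may pass through points of \<open>X - Y\<close> before its end, where the collection does not
  prescribe \<open>B\<close>; cutting it at its first exit from \<open>Y\<close> shows that these values of \<open>B\<close> are
  irrelevant.
\<close>

definition admissible :: "'a set \<Rightarrow> 'a set \<Rightarrow> ('a \<Rightarrow> 'a set) \<Rightarrow> bool" where
  "admissible X Y B \<longleftrightarrow>
     X \<noteq> {} \<and> Y \<noteq> {} \<and> X - Y \<noteq> {} \<and> (\<forall>x\<in>Y. B x \<noteq> {}) \<and>
     (\<exists>D::nat. \<forall>x\<in>Y. \<exists>d<D. \<exists>c::nat \<Rightarrow> 'a.
        (\<forall>i\<le>d. c i \<in> X) \<and> c 0 = x \<and> c d \<in> X - Y \<and>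
        (\<forall>i\<in>{1..d}. c i \<in> B (c (i - 1))))"

text \<open>
  Suprema and infima below are real-valued, so they have their usual meaning only when \<open>u\<close> is
  bounded on the (nonempty) set \<open>B x\<close>.
\<close>

definition subsolution ::
  "'a set \<Rightarrow> 'a set \<Rightarrow> ('a \<Rightarrow> 'a set) \<Rightarrow> real \<Rightarrow> ('a \<Rightarrow> real) \<Rightarrow> ('a \<Rightarrow> real) \<Rightarrow> ('a \<Rightarrow> real) \<Rightarrow> bool" where
  "subsolution X Y B \<mu> f F u \<longleftrightarrow>
     (\<forall>x\<in>Y. u x \<le> \<mu> * (SUP y\<in>B x. u y) + (1 - \<mu>) * (INF y\<in>B x. u y) + f x) \<and>
     (\<forall>x\<in>X - Y. u x = F x)"

definition supersolution ::
  "'a set \<Rightarrow> 'a set \<Rightarrow> ('a \<Rightarrow> 'a set) \<Rightarrow> real \<Rightarrow> ('a \<Rightarrow> real) \<Rightarrow> ('a \<Rightarrow> real) \<Rightarrow> ('a \<Rightarrow> real) \<Rightarrow> bool" where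
  "supersolution X Y B \<mu> f F u \<longleftrightarrow>
     (\<forall>x\<in>Y. u x \<ge> \<mu> * (SUP y\<in>B x. u y) + (1 - \<mu>) * (INF y\<in>B x. u y) + f x) \<and>
     (\<forall>x\<in>X - Y. u x = F x)"

end

theory Submission
  imports Defs
begin

text \<open>
  A positive source term makes the equation behave strictly under scaling. Let \<open>u\<close> be a subsolution,
  \<open>v\<close> a supersolution, \<open>\<kappa> > 1\<close>, and let \<open>m > 0\<close> be a lower bound of \<open>f\<close> on \<open>Y\<close>. The averaging
  operator \<open>\<mu> sup + (1 - \<mu>) inf\<close> is monotone, commutes with adding constants and is positively
  homogeneous. Hence \<open>\<kappa> v\<close> is a supersolution for the source \<open>\<kappa> f\<close>, which exceeds \<open>f\<close> by at least
  \<open>(\<kappa> - 1) m\<close>. If \<open>K\<close> is any upper bound of \<open>u - \<kappa> v\<close>, then monotonicity improves it at points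
  of \<open>Y\<close> to \<open>K - (\<kappa> - 1) m\<close>, by an amount that does not depend on the point. So no maximizing
  sequence for \<open>u - \<kappa> v\<close> can stay in \<open>Y\<close>, whether or not the supremum is attained: it is
  at most the supremum over the boundary \<open>X - Y\<close>, where \<open>u - \<kappa> v = (1 - \<kappa>) F\<close> is at most
  \<open>(\<kappa> - 1) sup \<bar>F\<bar>\<close>. Letting \<open>\<kappa>\<close> decrease to \<open>1\<close> gives \<open>u \<le> v\<close>.

  The three properties of the operator enter through \<open>SUP_le_affine\<close> and \<open>INF_le_affine\<close>. The
  estimate for fixed \<open>\<kappa>\<close> is \<open>subsolution_le_scaled_supersolution\<close>, and
  \<open>subsolution_le_supersolution\<close> is its limit. Both hold for any nonempty sets \<open>B x\<close> inside \<open>X\<close>.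
\<close>

lemma SUP_le_affine:
  fixes u v :: "'a \<Rightarrow> real"
  assumes "B \<noteq> {}" "bdd_above (v ` B)" "0 \<le> \<kappa>" "\<And>y. y \<in> B \<Longrightarrow> u y \<le> \<kappa> * v y + K"
  shows "(SUP y\<in>B. u y) \<le> \<kappa> * (SUP y\<in>B. v y) + K"
proof (rule cSUP_least[OF assms(1)])
  fix y assume "y \<in> B"
  then have "\<kappa> * v y \<le> \<kappa> * (SUP y\<in>B. v y)"
    by (intro mult_left_mono cSUP_upper assms)
  with assms(4)[OF \<open>y \<in> B\<close>] show "u y \<le> \<kappa> * (SUP y\<in>B. v y) + K"
    by linarith
qed

lemma INF_le_affine:
  fixes u v :: "'a \<Rightarrow> real"
  assumes "B \<noteq> {}" "bdd_below (u ` B)" "0 < \<kappa>" "\<And>y. y \<in> B \<Longrightarrow> u y \<le> \<kappa> * v y + K"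
  shows "(INF y\<in>B. u y) \<le> \<kappa> * (INF y\<in>B. v y) + K"
proof -
  have "((INF y\<in>B. u y) - K) / \<kappa> \<le> (INF y\<in>B. v y)"
  proof (rule cINF_greatest[OF assms(1)])
    fix y assume "y \<in> B"
    then have "(INF y\<in>B. u y) \<le> u y"
      by (intro cINF_lower assms)
    with assms(4)[OF \<open>y \<in> B\<close>] show "((INF y\<in>B. u y) - K) / \<kappa> \<le> v y"
      using assms(3) by (simp add: pos_divide_le_eq mult.commute)
  qed
  then show ?thesis
    using assms(3) by (simp add: pos_divide_le_eq mult.commute)
qed

text \<open>
  Applied to the supremum \<open>K\<close> of \<open>u - \<kappa> v\<close>, the gain \<open>(\<kappa> - 1) m\<close> on \<open>Y\<close> leaves only the boundary to
  produce \<open>K\<close>. The bound \<open>(\<kappa> - 1) C\<close> is the price of scaling, since \<open>\<kappa> v\<close> has boundary values \<open>\<kappa> F\<close>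
  and not \<open>F\<close>; it vanishes as \<open>\<kappa>\<close> tends to \<open>1\<close>.
\<close>

lemma subsolution_le_scaled_supersolution:
  assumes sub: "subsolution X Y B \<mu> f F u" and super: "supersolution X Y B \<mu> f F v"
    and \<mu>: "0 \<le> \<mu>" "\<mu> \<le> 1"
    and B: "\<And>x. x \<in> Y \<Longrightarrow> B x \<noteq> {}" "\<And>x. x \<in> Y \<Longrightarrow> B x \<subseteq> X"
    and u: "bdd_above (u ` X)" "bdd_below (u ` X)"
    and v: "bdd_above (v ` X)" "bdd_below (v ` X)"
    and m: "0 < m" "\<And>x. x \<in> Y \<Longrightarrow> m \<le> f x"
    and C: "\<And>x. x \<in> X - Y \<Longrightarrow> \<bar>F x\<bar> \<le> C"
    and \<kappa>: "1 < \<kappa>" and x: "x \<in> X"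
  shows "u x \<le> \<kappa> * v x + (\<kappa> - 1) * C"
proof -
  define K where "K = (SUP y\<in>X. u y - \<kappa> * v y)"
  obtain a where a: "\<And>y. y \<in> X \<Longrightarrow> u y \<le> a"
    using u(1) by (auto simp: bdd_above_def)
  obtain b where b: "\<And>y. y \<in> X \<Longrightarrow> b \<le> v y"
    using v(2) by (auto simp: bdd_below_def)
  have "u y - \<kappa> * v y \<le> a - \<kappa> * b" if "y \<in> X" for y
    using a[OF that] mult_left_mono[OF b[OF that], of \<kappa>] \<kappa> by linarith
  then have bdd: "bdd_above ((\<lambda>y. u y - \<kappa> * v y) ` X)"
    by (rule bdd_aboveI2)
  have K: "u y \<le> \<kappa> * v y + K" if "y \<in> X" for y
    using cSUP_upper[OF that bdd] unfolding K_def by linarith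
  have interior: "u y - \<kappa> * v y \<le> K - (\<kappa> - 1) * m" if y: "y \<in> Y" for y
  proof -
    let ?S = "\<lambda>w. SUP z\<in>B y. w z" and ?I = "\<lambda>w. INF z\<in>B y. w z"
    have on_B: "bdd_above (v ` B y)" "bdd_below (u ` B y)"
      using bdd_above_mono[OF v(1)] bdd_below_mono[OF u(2)] B(2)[OF y] by (simp_all add: image_mono)
    have K_on_B: "u z \<le> \<kappa> * v z + K" if "z \<in> B y" for z
      using B(2)[OF y] that by (intro K) blast
    have "?S u \<le> \<kappa> * ?S v + K"
      using \<kappa> by (intro SUP_le_affine[OF B(1)[OF y] on_B(1) _ K_on_B]) auto
    moreover have "?I u \<le> \<kappa> * ?I v + K"
      using \<kappa> by (intro INF_le_affine[OF B(1)[OF y] on_B(2) _ K_on_B]) auto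
    ultimately have "\<mu> * ?S u + (1 - \<mu>) * ?I u \<le> \<mu> * (\<kappa> * ?S v + K) + (1 - \<mu>) * (\<kappa> * ?I v + K)"
      using \<mu> by (intro add_mono mult_left_mono) auto
    also have "\<dots> = \<kappa> * (\<mu> * ?S v + (1 - \<mu>) * ?I v) + K"
      by (simp add: algebra_simps)
    also have "\<dots> \<le> \<kappa> * (v y - f y) + K"
    proof -
      have "\<mu> * ?S v + (1 - \<mu>) * ?I v \<le> v y - f y"
        using bspec[OF conjunct1[OF super[unfolded supersolution_def]] y] by linarith
      then show ?thesis
        using \<kappa> by simp
    qed
    finally have "u y \<le> \<kappa> * (v y - f y) + K + f y"
      using bspec[OF conjunct1[OF sub[unfolded subsolution_def]] y] by linarith
    moreover have "(\<kappa> - 1) * m \<le> (\<kappa> - 1) * f y"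
      using m(2)[OF y] \<kappa> by simp
    ultimately show ?thesis
      by (simp add: algebra_simps)
  qed
  have boundary: "u y - \<kappa> * v y \<le> (\<kappa> - 1) * C" if y: "y \<in> X - Y" for y
  proof -
    have "u y = F y" "v y = F y"
      using sub super y unfolding subsolution_def supersolution_def by auto
    then have "u y - \<kappa> * v y = (\<kappa> - 1) * (- F y)"
      by (simp add: algebra_simps)
    also have "\<dots> \<le> (\<kappa> - 1) * C"
      using C[OF y] \<kappa> by (intro mult_left_mono) auto
    finally show ?thesis .
  qed
  have "K \<le> max (K - (\<kappa> - 1) * m) ((\<kappa> - 1) * C)"
    using x interior boundary
    by (subst K_def, intro cSUP_least) (auto simp: le_max_iff_disj)
  \<comment> \<open>The first alternative is excluded because it would bound \<open>K\<close> by something smaller than \<open>K\<close>.\<close>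
  moreover have "0 < (\<kappa> - 1) * m"
    using m(1) \<kappa> by simp
  ultimately have "K \<le> (\<kappa> - 1) * C"
    by (simp add: max_def split: if_splits)
  with K[OF x] show ?thesis
    by linarith
qed

lemma subsolution_le_supersolution:
  assumes sub: "subsolution X Y B \<mu> f F u" and super: "supersolution X Y B \<mu> f F v"
    and \<mu>: "0 \<le> \<mu>" "\<mu> \<le> 1"
    and B: "\<And>x. x \<in> Y \<Longrightarrow> B x \<noteq> {}" "\<And>x. x \<in> Y \<Longrightarrow> B x \<subseteq> X"
    and u: "bdd_above (u ` X)" "bdd_below (u ` X)"
    and v: "bdd_above (v ` X)" "bdd_below (v ` X)"
    and m: "0 < m" "\<And>x. x \<in> Y \<Longrightarrow> m \<le> f x"
    and C: "\<And>x. x \<in> X - Y \<Longrightarrow> \<bar>F x\<bar> \<le> C"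
    and x: "x \<in> X"
  shows "u x \<le> v x"
proof (rule tendsto_lowerbound)
  show "((\<lambda>\<kappa>. \<kappa> * v x + (\<kappa> - 1) * C) \<longlongrightarrow> v x) (at_right 1)"
    by (auto intro!: tendsto_eq_intros)
  show "\<forall>\<^sub>F \<kappa> in at_right 1. u x \<le> \<kappa> * v x + (\<kappa> - 1) * C"
    using eventually_at_right_less
    by eventually_elim (rule subsolution_le_scaled_supersolution[OF assms(1-13) _ x])
qed simp

lemma bdd_above_abs_imp_bdd:
  fixes w :: "'a \<Rightarrow> real"
  assumes "bdd_above ((\<lambda>x. \<bar>w x\<bar>) ` X)"
  shows "bdd_above (w ` X)" "bdd_below (w ` X)"
proof -
  obtain M where "\<And>x. x \<in> X \<Longrightarrow> \<bar>w x\<bar> \<le> M"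
    using assms by (auto simp: bdd_above_def)
  then have "w x \<le> M" "- M \<le> w x" if "x \<in> X" for x
    using that by (simp_all add: abs_le_iff minus_le_iff)
  then show "bdd_above (w ` X)" "bdd_below (w ` X)"
    unfolding bdd_above_def bdd_below_def by blast+
qed

theorem corollary1p4:
  fixes X Y :: "'a set" and \<rho> :: "'a \<Rightarrow> 'a \<Rightarrow> real" and \<epsilon> \<mu> :: real
    and f F v_lower v_upper :: "'a \<Rightarrow> real"
  assumes "Metric_space X \<rho>" and "Metric_space.mbounded X \<rho> X"
    and "Y \<noteq> {}" and "Y \<subset> X"
    and "\<epsilon> > 0" and "0 < \<mu>" and "\<mu> < 1"
    and "admissible X Y (\<lambda>x. Metric_space.mball X \<rho> x \<epsilon>)"
    and "bdd_above ((\<lambda>x. \<bar>F x\<bar>) ` X)" and "bdd_above ((\<lambda>x. \<bar>f x\<bar>) ` X)"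
    and "(INF x\<in>Y. f x) > 0"
    and "subsolution X Y (\<lambda>x. Metric_space.mball X \<rho> x \<epsilon>) \<mu> f F v_lower"
    and "supersolution X Y (\<lambda>x. Metric_space.mball X \<rho> x \<epsilon>) \<mu> f F v_upper"
    and "bdd_above ((\<lambda>x. \<bar>v_lower x\<bar>) ` X)" and "bdd_above ((\<lambda>x. \<bar>v_upper x\<bar>) ` X)"
  shows "\<forall>x\<in>X. v_lower x \<le> v_upper x"
proof
  fix x assume x: "x \<in> X"
  interpret Metric_space X \<rho> by fact
  have "bdd_below (f ` Y)"
    using assms(4) by (intro bdd_below_mono[OF bdd_above_abs_imp_bdd(2)[OF assms(10)]]) blast
  then have f: "(INF x\<in>Y. f x) \<le> f y" if "y \<in> Y" for y
    using that by (rule cINF_lower)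
  obtain C where C: "\<And>y. y \<in> X \<Longrightarrow> \<bar>F y\<bar> \<le> C"
    using assms(9) by (auto simp: bdd_above_def)
  show "v_lower x \<le> v_upper x"
  proof (rule subsolution_le_supersolution[OF assms(12,13)])
    show "mball y \<epsilon> \<noteq> {}" if "y \<in> Y" for y
      using assms(8) that unfolding admissible_def by blast
    show "mball y \<epsilon> \<subseteq> X" for y
      by auto
    show "0 \<le> \<mu>" "\<mu> \<le> 1"
      using assms(6,7) by simp_all
    show "\<bar>F y\<bar> \<le> C" if "y \<in> X - Y" for y
      using that C by simp
  qed (fact x f assms(11) bdd_above_abs_imp_bdd[OF assms(14)] bdd_above_abs_imp_bdd[OF assms(15)])+
qed

end
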